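(* Let $W$ be a cocompact discrete reflection group of a CAT(0) space $X$, let $C$ be a chamber, and let $S$ be a minimal subset of the set $R$ of reflections in $W$ such that $C=\bigcap_{s\in S}X_s^+$. Let $x_0\in C$ and $w\in W$. Then there exists a reduced representation $w=s_1\cdots s_l$ ($s_i\in S$, $l=\ell(w)$) such that $$d_H([x_0,wx_0],P_{s_1,\dots,s_l})\le\operatorname{diam}\overline{C},$$ where $d_H$ is the Hausdorff distance, $[x,y]$ denotes the geodesic segment from $x$ to $y$, and $P_{s_1,\dots,s_l}=[x_0,s_1x_0]\cup[s_1x_0,(s_1s_2)x_0]\cup\cdots\cup[(s_1\cdots s_{l-1})x_0,wx_0]$.
   Context: An isometry $r$ of a geodesic space $X$ is a reflection if $r^2=\mathrm{id}$, the fixed-point set $F_r$ (the wall of $r$) has empty interior, $X\setminus F_r$ has exactly two convex connected components, and $r$ interchanges them. A reflection group is an isometry group generated by reflections. Let $W$ be a reflection group of $X$ acting properly (i.e. $\{\gamma\in W: \gamma x\in B(x,N)\}$ is finite for all $x\in X$, $N>0$), and $R$ the set of all reflections of $X$ lying in $W$. A chamber is a connected component $C$ of $X\setminus\bigcup_{r\in R}F_r$. $W$ is a cocompact discrete reflection group if $\overline{C}$ is compact and $\{\gamma\in W: \gamma C=C\}=\{1\}$. For $r\in R$, $X_r^+$ denotes the component of $X\setminus F_r$ containing $C$. $S\subset R$ is minimal with $C=\bigcap_{s\in S}X_s^+$; then $(W,S)$ is a Coxeter system, and $\ell$ is word length with respect to $S$. In a CAT(0) space geodesic segments between two points are unique.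 *)

theory Defs
  imports "HOL-Analysis.Analysis"
begin

text \<open>The space X is the whole type 'a (a metric space with its metric topology).\<close>

definition isometry :: "('a::metric_space \<Rightarrow> 'a) \<Rightarrow> bool" where
  "isometry f \<longleftrightarrow> bij f \<and> (\<forall>x y. dist (f x) (f y) = dist x y)"

definition geodesic_path :: "(real \<Rightarrow> 'a::metric_space) \<Rightarrow> 'a \<Rightarrow> 'a \<Rightarrow> bool" where
  "geodesic_path \<gamma> x y \<longleftrightarrow> \<gamma> 0 = x \<and> \<gamma> (dist x y) = y \<and>
     (\<forall>s\<in>{0..dist x y}. \<forall>t\<in>{0..dist x y}. dist (\<gamma> s) (\<gamma> t) = \<bar>s - t\<bar>)"

definition geodesic_space :: "'a::metric_space itself \<Rightarrow> bool" where
  "geodesic_space _ \<longleftrightarrow> (\<forall>x y::'a. \<exists>\<gamma>. geodesic_path \<gamma> x y)"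

text \<open>CAT(0) comparison inequality: for a geodesic triangle with vertex x and sides
  [x,y], [x,z], and any comparison triangle a b c in the Euclidean plane (here: complex),
  the distance between points on the two sides is at most the distance of their
  comparison points. (Every pair of points on two different sides of a triangle lies on
  two sides sharing a vertex, so this is the usual CAT(0) condition.)\<close>
definition CAT0 :: "'a::metric_space itself \<Rightarrow> bool" where
  "CAT0 T \<longleftrightarrow> geodesic_space T \<and>
    (\<forall>(x::'a) y z \<gamma>1 \<gamma>2 s t. geodesic_path \<gamma>1 x y \<longrightarrow> geodesic_path \<gamma>2 x z \<longrightarrow>
       s \<in> {0..dist x y} \<longrightarrow> t \<in> {0..dist x z} \<longrightarrow>
       (\<forall>a b c :: complex. dist a b = dist x y \<and> dist a c = dist x z \<and> dist b c = dist y z \<longrightarrow>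
          dist (\<gamma>1 s) (\<gamma>2 t) \<le>
          dist (a + complex_of_real (s / dist x y) * (b - a))
               (a + complex_of_real (t / dist x z) * (c - a))))"

text \<open>The geodesic segment [x,y] (unique in a CAT(0) space).\<close>
definition geodesic_segment :: "'a::metric_space \<Rightarrow> 'a \<Rightarrow> 'a set" where
  "geodesic_segment x y = (THE S. \<exists>\<gamma>. geodesic_path \<gamma> x y \<and> S = \<gamma> ` {0..dist x y})"

definition geod_convex :: "'a::metric_space set \<Rightarrow> bool" where
  "geod_convex A \<longleftrightarrow> (\<forall>x\<in>A. \<forall>y\<in>A. \<forall>\<gamma>. geodesic_path \<gamma> x y \<longrightarrow> \<gamma> ` {0..dist x y} \<subseteq> A)"

definition fixset :: "('a \<Rightarrow> 'a) \<Rightarrow> 'a set" where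
  "fixset r = {x. r x = x}"

definition reflection :: "('a::metric_space \<Rightarrow> 'a) \<Rightarrow> bool" where
  "reflection r \<longleftrightarrow> isometry r \<and> r \<circ> r = id \<and> interior (fixset r) = {} \<and>
     (\<exists>A B. components (UNIV - fixset r) = {A, B} \<and> A \<noteq> B \<and>
            geod_convex A \<and> geod_convex B \<and> r ` A = B \<and> r ` B = A)"

inductive_set gen_group :: "('a \<Rightarrow> 'a) set \<Rightarrow> ('a \<Rightarrow> 'a) set" for G where
  gen_id: "id \<in> gen_group G"
| gen_mult: "g \<in> G \<Longrightarrow> f \<in> gen_group G \<Longrightarrow> g \<circ> f \<in> gen_group G"
| gen_inv: "g \<in> G \<Longrightarrow> f \<in> gen_group G \<Longrightarrow> inv g \<circ> f \<in> gen_group G"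

definition reflection_group :: "('a::metric_space \<Rightarrow> 'a) set \<Rightarrow> bool" where
  "reflection_group W \<longleftrightarrow> (\<exists>G. (\<forall>g\<in>G. reflection g) \<and> W = gen_group G)"

definition acts_properly :: "('a::metric_space \<Rightarrow> 'a) set \<Rightarrow> bool" where
  "acts_properly W \<longleftrightarrow> (\<forall>x. \<forall>N>0. finite {\<gamma>\<in>W. \<gamma> x \<in> ball x N})"

definition reflections_in :: "('a::metric_space \<Rightarrow> 'a) set \<Rightarrow> ('a \<Rightarrow> 'a) set" where
  "reflections_in W = {r\<in>W. reflection r}"

definition chamber :: "('a::metric_space \<Rightarrow> 'a) set \<Rightarrow> 'a set \<Rightarrow> bool" where
  "chamber W C \<longleftrightarrow> C \<in> components (UNIV - (\<Union>r\<in>reflections_in W. fixset r))"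

definition cocompact_discrete :: "('a::metric_space \<Rightarrow> 'a) set \<Rightarrow> 'a set \<Rightarrow> bool" where
  "cocompact_discrete W C \<longleftrightarrow> compact (closure C) \<and> {\<gamma>\<in>W. \<gamma> ` C = C} = {id}"

definition half_plus :: "('a::metric_space \<Rightarrow> 'a) \<Rightarrow> 'a set \<Rightarrow> 'a set" where
  "half_plus r C = \<Union>{A \<in> components (UNIV - fixset r). C \<subseteq> A}"

definition minimal_generating :: "('a::metric_space \<Rightarrow> 'a) set \<Rightarrow> 'a set \<Rightarrow> ('a \<Rightarrow> 'a) set \<Rightarrow> bool" where
  "minimal_generating W C S \<longleftrightarrow> S \<subseteq> reflections_in W \<and> C = (\<Inter>s\<in>S. half_plus s C) \<and>
     (\<forall>S'. S' \<subset> S \<longrightarrow> C \<noteq> (\<Inter>s\<in>S'. half_plus s C))"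

definition word_prod :: "('a \<Rightarrow> 'a) list \<Rightarrow> 'a \<Rightarrow> 'a" where
  "word_prod ss = foldr (\<circ>) ss id"

definition word_length :: "('a \<Rightarrow> 'a) set \<Rightarrow> ('a \<Rightarrow> 'a) \<Rightarrow> nat" where
  "word_length S w = (LEAST n. \<exists>ss. length ss = n \<and> set ss \<subseteq> S \<and> word_prod ss = w)"

definition gallery_path :: "('a::metric_space \<Rightarrow> 'a) list \<Rightarrow> 'a \<Rightarrow> 'a set" where
  "gallery_path ss x0 = insert x0 (\<Union>i<length ss.
      geodesic_segment (word_prod (take i ss) x0) (word_prod (take (Suc i) ss) x0))"

definition hausdorff_dist :: "'a::metric_space set \<Rightarrow> 'a set \<Rightarrow> ereal" where
  "hausdorff_dist A B = max (SUP a\<in>A. ereal (infdist a B)) (SUP b\<in>B. ereal (infdist b A))"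

end

theory Submission
  imports Defs
begin

text \<open>Follow the geodesic from \<open>x0\<close> to \<open>w x0\<close> up to the last point \<open>p\<close> at which it lies in
  the closure of \<open>C\<close>. There it lies on the wall of some \<open>s \<in> S\<close> that separates \<open>C\<close> from \<open>w C\<close>, so
  passing to the adjacent chamber \<open>s C\<close> shortens the remaining word, and \<open>p\<close> belongs to both closed
  chambers. Iterating gives a reduced gallery whose closed chambers cover the geodesic and in which
  consecutive closed chambers meet on it. Each point of the geodesic is then close to a vertex
  \<open>s\<^sub>1\<cdots>s\<^sub>i x0\<close>, and by convexity of balls each edge of the gallery path is close to the geodesic.
  No counting of walls is needed: the only Coxeter-theoretic input is that \<open>s\<close> is the only
  reflection separating \<open>C\<close> from \<open>s C\<close>, which is where the minimality of \<open>S\<close> enters.\<close>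

section \<open>Isometries and reflections\<close>

lemma isometry_bij: "isometry f \<Longrightarrow> bij f"
  by (simp add: isometry_def)

lemma isometry_dist: "isometry f \<Longrightarrow> dist (f x) (f y) = dist x y"
  by (simp add: isometry_def)

lemma isometry_inv_f: "isometry f \<Longrightarrow> inv f (f x) = x"
  by (simp add: bij_is_inj isometry_bij)

lemma isometry_f_inv: "isometry f \<Longrightarrow> f (inv f x) = x"
  by (simp add: bij_is_surj isometry_bij surj_f_inv_f)

lemma isometry_id: "isometry id"
  by (simp add: isometry_def)

lemma isometry_comp: "isometry f \<Longrightarrow> isometry g \<Longrightarrow> isometry (f \<circ> g)"
  by (simp add: isometry_def bij_comp)

lemma isometry_inv:
  assumes "isometry f" shows "isometry (inv f)"
  unfolding isometry_def
proof (intro conjI allI)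
  show "bij (inv f)" using assms bij_imp_bij_inv isometry_bij by blast
  show "dist (inv f x) (inv f y) = dist x y" for x y
    using isometry_dist[OF assms, of "inv f x" "inv f y"] by (simp add: isometry_f_inv[OF assms])
qed

lemma isometry_continuous_on: "isometry f \<Longrightarrow> continuous_on A f"
  unfolding continuous_on_iff by (metis isometry_dist)

lemma isometry_closure_image:
  assumes "isometry f"
  shows "closure (f ` A) = f ` closure A"
proof -
  have "f z \<in> closure (f ` A) \<longleftrightarrow> z \<in> closure A" for z
    by (simp add: closure_approachable isometry_dist[OF assms])
  then have "f -` closure (f ` A) = closure A" by blast
  then show ?thesis
    using surj_image_vimage_eq[OF bij_is_surj[OF isometry_bij[OF assms]]] by metis
qed

lemma isometry_interior_image:
  assumes "isometry f"
  shows "interior (f ` A) = f ` interior A"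
  using isometry_closure_image[OF assms, of "- A"] bij_image_Compl_eq[OF isometry_bij[OF assms]]
  by (metis interior_closure)

lemma isometry_components_image:
  assumes f: "isometry f"
  shows "components (f ` A) = (`) f ` components A"
proof -
  have sub: "g ` c \<in> components (g ` B)" if g: "isometry g" and c: "c \<in> components B"
    for g :: "'a \<Rightarrow> 'a" and B c
    unfolding in_components_maximal
  proof (intro conjI allI impI)
    show "g ` c \<noteq> {}" "g ` c \<subseteq> g ` B"
      using c in_components_nonempty in_components_subset by blast+
    show "connected (g ` c)"
      using c g in_components_connected connected_continuous_image isometry_continuous_on by blast
    fix d assume d: "d \<noteq> {} \<and> g ` c \<subseteq> d \<and> d \<subseteq> g ` B \<and> connected d"
    have dd: "g ` inv g ` d = d"
      by (simp add: image_image isometry_f_inv[OF g])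
    have "connected (inv g ` d)"
      using d g connected_continuous_image isometry_continuous_on isometry_inv by blast
    moreover have "inv g ` g ` c \<subseteq> inv g ` d" "inv g ` d \<subseteq> inv g ` g ` B" "inv g ` d \<noteq> {}"
      using d by (meson image_mono, meson image_mono, blast)
    ultimately have "inv g ` d = c"
      using c unfolding in_components_maximal by (simp add: image_image isometry_inv_f[OF g])
    then show "d = g ` c" using dd by simp
  qed
  show ?thesis
  proof
    show "(`) f ` components A \<subseteq> components (f ` A)" using sub[OF f] by blast
    show "components (f ` A) \<subseteq> (`) f ` components A"
    proof
      fix c assume "c \<in> components (f ` A)"
      from sub[OF isometry_inv[OF f] this] have "inv f ` c \<in> components A"
        by (simp add: image_image isometry_inv_f[OF f])
      moreover have "c = f ` inv f ` c" by (simp add: image_image isometry_f_inv[OF f])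
      ultimately show "c \<in> (`) f ` components A" by blast
    qed
  qed
qed

lemma reflection_isometry: "reflection r \<Longrightarrow> isometry r"
  by (simp add: reflection_def)

lemma reflection_invol: "reflection r \<Longrightarrow> r (r x) = x"
  unfolding reflection_def by (metis comp_apply id_apply)

lemma reflection_inv: "reflection r \<Longrightarrow> inv r = r"
  by (simp add: reflection_def inv_unique_comp)

lemma reflection_components:
  assumes "reflection r"
  obtains A B where "components (UNIV - fixset r) = {A, B}" "A \<noteq> B"
    "geod_convex A" "geod_convex B" "r ` A = B" "r ` B = A"
  using assms unfolding reflection_def by (elim conjE exE) (rule that)

lemma geod_convex_image:
  assumes f: "isometry f" and A: "geod_convex A"
  shows "geod_convex (f ` A)"
  unfolding geod_convex_def
proof (intro ballI allI impI)
  fix x y \<gamma> assume "x \<in> f ` A" "y \<in> f ` A" and g: "geodesic_path \<gamma> x y"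
  then obtain x' y' where xy: "x = f x'" "y = f y'" "x' \<in> A" "y' \<in> A" by blast
  have d: "dist x y = dist x' y'" by (simp add: xy isometry_dist[OF f])
  have "geodesic_path (inv f \<circ> \<gamma>) x' y'"
    using g d unfolding geodesic_path_def
    by (simp add: xy isometry_inv_f[OF f] isometry_dist[OF isometry_inv[OF f]])
  then have "(inv f \<circ> \<gamma>) ` {0..dist x y} \<subseteq> A"
    using A xy d unfolding geod_convex_def by metis
  then have "f ` inv f ` \<gamma> ` {0..dist x y} \<subseteq> f ` A"
    by (intro image_mono) (simp add: image_comp)
  then show "\<gamma> ` {0..dist x y} \<subseteq> f ` A"
    by (simp add: image_image isometry_f_inv[OF f])
qed

text \<open>Needed so that \<open>W\<close> permutes its walls: an isometry preserves each clause in
  the definition of a reflection.\<close>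

lemma reflection_conj:
  assumes r: "reflection r" and u: "isometry u"
  shows "reflection (u \<circ> r \<circ> inv u)" "fixset (u \<circ> r \<circ> inv u) = u ` fixset r"
proof -
  note [simp] = isometry_f_inv[OF u] isometry_inv_f[OF u]
  show fx: "fixset (u \<circ> r \<circ> inv u) = u ` fixset r"
  proof (intro set_eqI iffI)
    fix x assume "x \<in> fixset (u \<circ> r \<circ> inv u)"
    then have "u (r (inv u x)) = x" by (simp add: fixset_def)
    then have "r (inv u x) = inv u x" using isometry_inv_f[OF u] by metis
    then show "x \<in> u ` fixset r" by (intro image_eqI[of _ _ "inv u x"]) (simp_all add: fixset_def)
  next
    fix x assume "x \<in> u ` fixset r"
    then show "x \<in> fixset (u \<circ> r \<circ> inv u)" by (auto simp: fixset_def)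
  qed
  obtain A B where AB: "components (UNIV - fixset r) = {A, B}" "A \<noteq> B"
    "geod_convex A" "geod_convex B" "r ` A = B" "r ` B = A"
    using reflection_components[OF r] .
  have "components (UNIV - u ` fixset r) = (`) u ` {A, B}"
    using isometry_components_image[OF u, of "- fixset r"] AB(1)
    by (simp only: Compl_eq_Diff_UNIV[symmetric] bij_image_Compl_eq[OF isometry_bij[OF u]])
  then have "components (UNIV - u ` fixset r) = {u ` A, u ` B}" by simp
  moreover have "u ` A \<noteq> u ` B"
    using AB(2) inj_image_eq_iff[OF bij_is_inj[OF isometry_bij[OF u]]] by blast
  moreover have "(u \<circ> r \<circ> inv u) ` u ` A = u ` B" "(u \<circ> r \<circ> inv u) ` u ` B = u ` A"
    using AB(5,6) by (auto simp: image_image reflection_invol[OF r])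
  moreover have "isometry (u \<circ> r \<circ> inv u)"
    using r u by (simp add: isometry_comp isometry_inv reflection_isometry)
  moreover have "(u \<circ> r \<circ> inv u) \<circ> (u \<circ> r \<circ> inv u) = id"
    by (auto simp: reflection_invol[OF r])
  moreover have "interior (u ` fixset r) = {}"
    using r by (simp add: isometry_interior_image[OF u] reflection_def)
  ultimately show "reflection (u \<circ> r \<circ> inv u)"
    unfolding reflection_def fx
    using geod_convex_image[OF u AB(3)] geod_convex_image[OF u AB(4)] by (intro conjI exI)
qed

lemma closed_fixset:
  assumes "isometry r" shows "closed (fixset r)"
  unfolding fixset_def
  using closed_Collect_eq isometry_continuous_on[OF assms] continuous_on_id by blast

section \<open>Geodesics in CAT(0) spaces\<close>

text \<open>Unlike in \<open>geodesic_path\<close> the domain is any interval, so a piece of a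
  geodesic is again one without shifting its parameter.\<close>

definition geod_on :: "(real \<Rightarrow> 'a::metric_space) \<Rightarrow> real \<Rightarrow> real \<Rightarrow> bool" where
  "geod_on \<gamma> a b \<longleftrightarrow> (\<forall>s\<in>{a..b}. \<forall>t\<in>{a..b}. dist (\<gamma> s) (\<gamma> t) = \<bar>s - t\<bar>)"

lemma geodesic_path_iff:
  "geodesic_path \<gamma> x y \<longleftrightarrow> \<gamma> 0 = x \<and> \<gamma> (dist x y) = y \<and> geod_on \<gamma> 0 (dist x y)"
  by (simp add: geodesic_path_def geod_on_def)

lemma geod_on_dist: "geod_on \<gamma> a b \<Longrightarrow> s \<in> {a..b} \<Longrightarrow> t \<in> {a..b} \<Longrightarrow> dist (\<gamma> s) (\<gamma> t) = \<bar>s - t\<bar>"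
  by (simp add: geod_on_def)

lemma geod_on_path:
  assumes "geod_on \<gamma> a b" "a \<le> b"
  shows "geodesic_path (\<lambda>t. \<gamma> (a + t)) (\<gamma> a) (\<gamma> b)" "dist (\<gamma> a) (\<gamma> b) = b - a"
proof -
  show d: "dist (\<gamma> a) (\<gamma> b) = b - a"
    using assms by (simp add: geod_on_def)
  show "geodesic_path (\<lambda>t. \<gamma> (a + t)) (\<gamma> a) (\<gamma> b)"
    using assms by (auto simp: geodesic_path_def d geod_on_def)
qed

lemma geod_on_subset: "geod_on \<gamma> a b \<Longrightarrow> a \<le> a' \<Longrightarrow> b' \<le> b \<Longrightarrow> geod_on \<gamma> a' b'"
  by (auto simp: geod_on_def)

lemma geod_on_isometry: "isometry f \<Longrightarrow> geod_on \<gamma> a b \<Longrightarrow> geod_on (f \<circ> \<gamma>) a b"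
  by (simp add: geod_on_def isometry_dist)

lemma geod_on_continuous: "geod_on \<gamma> a b \<Longrightarrow> continuous_on {a..b} \<gamma>"
  unfolding continuous_on_iff geod_on_def by (metis dist_real_def)

lemma geod_on_connected: "geod_on \<gamma> a b \<Longrightarrow> connected (\<gamma> ` {a..b})"
  by (simp add: connected_continuous_image geod_on_continuous)

lemma geod_convexD:
  assumes "geod_convex A" "geod_on \<gamma> a b" "\<gamma> a \<in> A" "\<gamma> b \<in> A" "t \<in> {a..b}"
  shows "\<gamma> t \<in> A"
proof -
  have ab: "a \<le> b" using assms(5) by simp
  have "(\<lambda>t. \<gamma> (a + t)) ` {0..b - a} \<subseteq> A"
    using assms(1,3,4) geod_on_path[OF assms(2) ab] unfolding geod_convex_def by metis
  moreover have "\<gamma> t = (\<lambda>t. \<gamma> (a + t)) (t - a)" by simp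
  ultimately show ?thesis using assms(5) by (metis atLeastAtMost_iff diff_ge_0_iff_ge diff_right_mono image_subset_iff)
qed

lemma CAT0_geodesic:
  assumes "CAT0 TYPE('a::metric_space)"
  obtains \<gamma> where "\<gamma> 0 = (x::'a)" "\<gamma> (dist x y) = y" "geod_on \<gamma> 0 (dist x y)"
  using assms unfolding CAT0_def geodesic_space_def geodesic_path_iff by blast

text \<open>Apply the CAT(0) inequality to the degenerate triangle with vertices x, y, y: the
  comparison points at time t coincide, so the bound is 0.\<close>

lemma CAT0_geodesic_path_unique:
  fixes x y :: "'a::metric_space"
  assumes "CAT0 TYPE('a)" "geodesic_path \<gamma> x y" "geodesic_path \<delta> x y" "t \<in> {0..dist x y}"
  shows "\<gamma> t = \<delta> t"
proof -
  have "dist (0::complex) (complex_of_real (dist x y)) = dist x y" by simp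
  moreover have "dist (complex_of_real (dist x y)) (complex_of_real (dist x y)) = dist y y" by simp
  ultimately have "dist (\<gamma> t) (\<delta> t) \<le>
      dist (0 + complex_of_real (t / dist x y) * (complex_of_real (dist x y) - 0))
           (0 + complex_of_real (t / dist x y) * (complex_of_real (dist x y) - 0))"
    using assms unfolding CAT0_def by blast
  then show ?thesis by simp
qed

lemma CAT0_geod_on_unique:
  fixes \<gamma> :: "real \<Rightarrow> 'a::metric_space"
  assumes "CAT0 TYPE('a)" "geod_on \<gamma> a b" "geod_on \<delta> a b" "\<gamma> a = \<delta> a" "\<gamma> b = \<delta> b" "t \<in> {a..b}"
  shows "\<gamma> t = \<delta> t"
proof -
  have ab: "a \<le> b" using assms(6) by simp
  note * = geod_on_path[OF assms(2) ab] geod_on_path[OF assms(3) ab]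
  have "\<gamma> (a + (t - a)) = \<delta> (a + (t - a))"
    using CAT0_geodesic_path_unique[OF assms(1) *(1), of "\<lambda>t. \<delta> (a + t)" "t - a"] * assms(4-6) by simp
  then show ?thesis by simp
qed

lemma CAT0_geodesic_segment:
  fixes x y :: "'a::metric_space"
  assumes "CAT0 TYPE('a)" "geodesic_path \<gamma> x y"
  shows "geodesic_segment x y = \<gamma> ` {0..dist x y}"
  unfolding geodesic_segment_def
proof (rule the_equality)
  show "\<exists>\<delta>. geodesic_path \<delta> x y \<and> \<gamma> ` {0..dist x y} = \<delta> ` {0..dist x y}"
    using assms by blast
  show "S = \<gamma> ` {0..dist x y}" if "\<exists>\<delta>. geodesic_path \<delta> x y \<and> S = \<delta> ` {0..dist x y}" for S
    using that CAT0_geodesic_path_unique[OF assms] by (metis image_cong)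
qed

text \<open>The CAT(0) inequality is stated for all comparison triangles, so one must be exhibited
  before it can be used.\<close>

lemma comparison_triangle:
  fixes p q r :: real
  assumes "p > 0" "q \<ge> 0" "r \<ge> 0" "p \<le> q + r" "q \<le> p + r" "r \<le> p + q"
  obtains c :: complex where "cmod c = q" "cmod (complex_of_real p - c) = r"
proof -
  \<comment> \<open>The law of cosines fixes the real part X of the third vertex; the triangle
    inequalities give |X| <= q, which makes the radicand in c nonnegative.\<close>
  define X where "X = (p\<^sup>2 + q\<^sup>2 - r\<^sup>2) / (2 * p)"
  have 1: "2 * p * X = p\<^sup>2 + q\<^sup>2 - r\<^sup>2" using assms(1) by (simp add: X_def)
  have "r\<^sup>2 \<le> (p + q)\<^sup>2" using assms by (intro power_mono) auto
  then have "2 * p * X \<ge> 2 * p * (- q)" unfolding 1 by (simp add: power2_eq_square algebra_simps)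
  then have "- q \<le> X" using assms(1) by (meson mult_le_cancel_left_pos zero_less_mult_iff zero_less_numeral)
  moreover have "(p - q)\<^sup>2 \<le> r\<^sup>2" using assms by (intro abs_le_square_iff[THEN iffD1]) auto
  then have "2 * p * X \<le> 2 * p * q" unfolding 1 by (simp add: power2_eq_square algebra_simps)
  then have "X \<le> q" using assms(1) by (meson mult_le_cancel_left_pos zero_less_mult_iff zero_less_numeral)
  ultimately have X: "X\<^sup>2 \<le> q\<^sup>2" using abs_le_square_iff[of X q] by auto
  define c where "c = Complex X (sqrt (q\<^sup>2 - X\<^sup>2))"
  have "cmod c = q" using X assms by (simp add: c_def cmod_def)
  moreover have "(p - X)\<^sup>2 + (q\<^sup>2 - X\<^sup>2) = r\<^sup>2"
    using 1 by (simp add: power2_eq_square algebra_simps)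
  then have "cmod (complex_of_real p - c) = r" using X assms by (simp add: c_def cmod_def)
  ultimately show ?thesis using that by blast
qed

text \<open>Comparison with a planar triangle whose third vertex stands for p reduces the claim to
  the convexity of a Euclidean disc.\<close>

lemma CAT0_dist_segment_le:
  fixes x y p :: "'a::metric_space"
  assumes cat: "CAT0 TYPE('a)" and z: "z \<in> geodesic_segment x y"
    and px: "dist x p \<le> D" and py: "dist y p \<le> D"
  shows "dist z p \<le> D"
proof -
  obtain \<gamma> where \<gamma>: "geodesic_path \<gamma> x y"
    using CAT0_geodesic[OF cat] unfolding geodesic_path_iff by metis
  obtain t where t: "t \<in> {0..dist x y}" "z = \<gamma> t"
    using z CAT0_geodesic_segment[OF cat \<gamma>] by blast
  obtain \<delta> where \<delta>: "geodesic_path \<delta> x p"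
    using CAT0_geodesic[OF cat] unfolding geodesic_path_iff by metis
  show ?thesis
  proof (cases "x = y \<or> x = p")
    case True
    then show ?thesis
    proof
      assume "x = y"
      then have "z = x" using t \<gamma> by (simp add: geodesic_path_def)
      then show ?thesis using px by simp
    next
      assume xp: "x = p"
      have "dist z x = t" using t \<gamma> unfolding geodesic_path_iff geod_on_def by fastforce
      then show ?thesis using t py xp by (simp add: dist_commute)
    qed
  next
    case False
    obtain c where c: "cmod c = dist x p" "cmod (complex_of_real (dist x y) - c) = dist y p"
      by (rule comparison_triangle[of "dist x y" "dist x p" "dist y p"])
        (use False dist_triangle[of x y p] dist_triangle[of x p y] dist_triangle[of y p x] in
          \<open>auto simp: dist_commute\<close>)
    let ?b = "complex_of_real (dist x y)" and ?l = "complex_of_real (t / dist x y)"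
    have tri: "dist 0 ?b = dist x y \<and> dist 0 c = dist x p \<and> dist ?b c = dist y p"
      using c by (simp add: dist_norm)
    \<comment> \<open>At the full parameter \<open>dist x p\<close> the second comparison point is
      the vertex c itself.\<close>
    have "dist (\<gamma> t) (\<delta> (dist x p)) \<le>
      dist (0 + ?l * (?b - 0)) (0 + complex_of_real (dist x p / dist x p) * (c - 0))"
      using cat \<gamma> \<delta> t(1) tri unfolding CAT0_def by (meson atLeastAtMost_iff order_refl zero_le_dist)
    then have "dist z p \<le> dist (?l * ?b) c"
      using \<delta> False t by (simp add: geodesic_path_def)
    moreover have "?l * ?b \<in> cball c D"
    proof -
      have "0 \<in> cball c D" "?b \<in> cball c D"
        using tri px py by (auto simp: dist_commute)
      then have "(1 - t / dist x y) *\<^sub>R 0 + (t / dist x y) *\<^sub>R ?b \<in> cball c D"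
        using t False by (intro convexD_alt[OF convex_cball]) auto
      then show ?thesis by (simp add: scaleR_conv_of_real)
    qed
    ultimately show ?thesis by (simp add: dist_commute)
  qed
qed

text \<open>The isometry maps the geodesic to one with the same endpoints, and geodesics are
  unique.\<close>

lemma CAT0_fixset_convex:
  fixes \<gamma> :: "real \<Rightarrow> 'a::metric_space"
  assumes "CAT0 TYPE('a)" "isometry f" "geod_on \<gamma> a b" "\<gamma> a \<in> fixset f" "\<gamma> b \<in> fixset f" "t \<in> {a..b}"
  shows "\<gamma> t \<in> fixset f"
  using CAT0_geod_on_unique[OF assms(1) geod_on_isometry[OF assms(2,3)] assms(3)] assms(4-6)
  by (simp add: fixset_def)

section \<open>Half-spaces\<close>

text \<open>Replaces the components in the definition of a reflection by two open convex sets,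
  symmetrically in P and N, so that later arguments apply from either side of the wall.\<close>

definition sides :: "('a::metric_space \<Rightarrow> 'a) \<Rightarrow> 'a set \<Rightarrow> 'a set \<Rightarrow> bool" where
  "sides r P N \<longleftrightarrow> reflection r \<and> P \<union> N = - fixset r \<and> P \<inter> N = {} \<and> open P \<and> open N \<and>
     geod_convex P \<and> geod_convex N \<and> r ` P = N \<and> r ` N = P"

lemma sidesD:
  assumes "sides r P N"
  shows "reflection r" "isometry r" "P \<union> N = - fixset r" "P \<inter> N = {}" "open P" "open N"
    "geod_convex P" "geod_convex N" "x \<in> P \<Longrightarrow> r x \<in> N" "x \<in> N \<Longrightarrow> r x \<in> P"
proof -
  note s = assms[unfolded sides_def]
  show "reflection r" "P \<union> N = - fixset r" "P \<inter> N = {}" "open P" "open N"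
    "geod_convex P" "geod_convex N"
    using s by - (elim conjE, assumption)+
  then show "isometry r" using reflection_isometry by blast
  have "r ` P = N" "r ` N = P" using s by - (elim conjE, assumption)+
  then show "x \<in> P \<Longrightarrow> r x \<in> N" "x \<in> N \<Longrightarrow> r x \<in> P" by (metis imageI)+
qed

lemma sides_iff:
  assumes "sides r P N"
  shows "x \<in> N \<longleftrightarrow> x \<notin> P \<and> x \<notin> fixset r"
  using sidesD(3,4)[OF assms] by blast

lemma sides_half_plus:
  assumes r: "reflection r" and C: "connected C" "C \<noteq> {}" "C \<inter> fixset r = {}"
  shows "sides r (half_plus r C) (r ` half_plus r C)" "C \<subseteq> half_plus r C"
proof -
  obtain A B where AB: "components (UNIV - fixset r) = {A, B}" "A \<noteq> B"
    "geod_convex A" "geod_convex B" "r ` A = B" "r ` B = A"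
    using reflection_components[OF r] .
  have un: "A \<union> B = - fixset r"
    using Union_components[of "UNIV - fixset r"] AB(1) by auto
  have disj: "A \<inter> B = {}"
    using components_nonoverlap[of A "UNIV - fixset r" B] AB(1,2) by blast
  have opn: "open (UNIV - fixset r)"
    using closed_fixset[OF reflection_isometry[OF r]] by (simp add: open_Diff)
  \<comment> \<open>A component is relatively closed in the complement of the wall; since there are
    only two, the other is open.\<close>
  have op: "open Y" if XY: "X \<in> components (UNIV - fixset r)" "X \<union> Y = - fixset r" "X \<inter> Y = {}" for X Y
  proof -
    obtain T where T: "closed T" "X = (UNIV - fixset r) \<inter> T"
      using closedin_component[OF XY(1)] by (metis closedin_closed)
    have "Y = (UNIV - fixset r) - T" using XY T by blast
    then show ?thesis using opn T by (simp add: open_Diff)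
  qed
  have sAB: "sides r A B" "sides r B A"
    unfolding sides_def using r un disj AB(3-6) op[of A B] op[of B A]
    by (simp_all add: AB(1) Un_commute Int_commute)
  obtain D where D: "D \<in> components (UNIV - fixset r)" "C \<subseteq> D"
    using exists_component_superset[of C "UNIV - fixset r"] C by auto
  have "{A \<in> components (UNIV - fixset r). C \<subseteq> A} = {D}"
    using D C(2) AB(1) disj by auto
  then have hp: "half_plus r C = D" by (simp add: half_plus_def)
  then show "C \<subseteq> half_plus r C" using D by simp
  have "D = A \<or> D = B" using D(1) AB(1) by simp
  then show "sides r (half_plus r C) (r ` half_plus r C)"
    unfolding hp using sAB AB(5,6) by metis
qed

lemma sides_crossing:
  assumes s: "sides r P N" and T: "connected T" and x: "x \<in> T" "x \<in> P" and y: "y \<in> T" "y \<notin> P"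
  shows "T \<inter> fixset r \<noteq> {}"
proof
  assume "T \<inter> fixset r = {}"
  then have "T \<subseteq> P \<union> N" "y \<in> N" using y sidesD(3)[OF s] by blast+
  then show False
    using connectedD[OF T sidesD(5,6)[OF s]] x y sidesD(4)[OF s] by blast
qed

lemma sides_sym: "sides r P N \<Longrightarrow> sides r N P"
  unfolding sides_def by (simp add: Un_commute Int_commute)

text \<open>Both a departure into an open half-space and the return from it meet the wall; the
  convexity of the wall then forces the intermediate stretch onto it.\<close>

lemma closed_half_space_convex:
  fixes \<gamma> :: "real \<Rightarrow> 'a::metric_space"
  assumes cat: "CAT0 TYPE('a)" and s: "sides r P N" and g: "geod_on \<gamma> a b"
    and ends: "\<gamma> a \<notin> N" "\<gamma> b \<notin> N" and t: "t \<in> {a..b}"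
  shows "\<gamma> t \<notin> N"
proof
  assume N: "\<gamma> t \<in> N"
  have g1: "geod_on \<gamma> a t" and g2: "geod_on \<gamma> t b"
    using geod_on_subset[OF g] t by auto
  have "\<gamma> ` {a..t} \<inter> fixset r \<noteq> {}"
    by (rule sides_crossing[OF sides_sym[OF s] geod_on_connected[OF g1] _ N _ ends(1)]) (use t in auto)
  moreover have "\<gamma> ` {t..b} \<inter> fixset r \<noteq> {}"
    by (rule sides_crossing[OF sides_sym[OF s] geod_on_connected[OF g2] _ N _ ends(2)]) (use t in auto)
  ultimately obtain t1 t2 where t12: "t1 \<in> {a..t}" "\<gamma> t1 \<in> fixset r" "t2 \<in> {t..b}" "\<gamma> t2 \<in> fixset r"
    by blast
  have "geod_on \<gamma> t1 t2" using geod_on_subset[OF g] t12 by auto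
  then have "\<gamma> t \<in> fixset r"
    using CAT0_fixset_convex[OF cat sidesD(2)[OF s]] t12 by (meson atLeastAtMost_iff)
  then show False using N sides_iff[OF s] by blast
qed

text \<open>Reflecting the part of a geodesic behind the wall gives a path of the same length through
  the wall. If it were a geodesic, it would contradict the convexity of the half-space.\<close>

lemma dist_reflect_less:
  fixes y z :: "'a::metric_space"
  assumes cat: "CAT0 TYPE('a)" and s: "sides r P N" and y: "y \<in> P" and z: "z \<in> N"
  shows "dist y (r z) < dist y z"
proof (rule ccontr)
  assume "\<not> ?thesis"
  then have ge: "dist y z \<le> dist y (r z)" by simp
  have iso: "isometry r" using sidesD(2)[OF s] .
  obtain \<gamma> where \<gamma>: "\<gamma> 0 = y" "\<gamma> (dist y z) = z" "geod_on \<gamma> 0 (dist y z)"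
    using CAT0_geodesic[OF cat] .
  let ?d = "dist y z"
  have "\<gamma> ` {0..?d} \<inter> fixset r \<noteq> {}"
  proof (rule sides_crossing[OF s geod_on_connected[OF \<gamma>(3)] _ y])
    show "y \<in> \<gamma> ` {0..?d}" using \<gamma>(1) by (intro image_eqI[of _ _ 0]) auto
    show "z \<in> \<gamma> ` {0..?d}" using \<gamma>(2) by (intro image_eqI[of _ _ ?d]) auto
    show "z \<notin> P" using sides_iff[OF s] z by blast
  qed
  then obtain m where m: "m \<in> {0..?d}" "r (\<gamma> m) = \<gamma> m" unfolding fixset_def by blast
  define \<delta> where "\<delta> t = (if t \<le> m then \<gamma> t else r (\<gamma> t))" for t
  have \<delta>': "\<delta> t = r (\<gamma> t)" if "m \<le> t" for t using that m by (auto simp: \<delta>_def)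
  have d0: "\<delta> 0 = y" and d1: "\<delta> ?d = r z"
    using m \<gamma> \<delta>'[of ?d] by (auto simp: \<delta>_def)
  have same: "dist (\<delta> s) (\<delta> t) = \<bar>s - t\<bar>"
    if "s \<in> {0..?d}" "t \<in> {0..?d}" "s \<le> m \<and> t \<le> m \<or> m \<le> s \<and> m \<le> t" for s t
    using that(3)
  proof
    assume "s \<le> m \<and> t \<le> m"
    then show ?thesis using geod_on_dist[OF \<gamma>(3) that(1,2)] by (simp add: \<delta>_def)
  next
    assume "m \<le> s \<and> m \<le> t"
    then show ?thesis using geod_on_dist[OF \<gamma>(3) that(1,2)] by (simp add: \<delta>' isometry_dist[OF iso])
  qed
  have mixed: "dist (\<delta> s) (\<delta> t) \<le> t - s" if "s \<in> {0..m}" "t \<in> {m..?d}" for s t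
    using same[of s m] same[of m t] dist_triangle[of "\<delta> s" "\<delta> t" "\<delta> m"] that m by auto
  \<comment> \<open>From y to \<open>r z\<close> the path has length \<open>?d\<close>, which by
    assumption is at most their distance, so the triangle inequalities along it are
    equalities.\<close>
  have mixed': "dist (\<delta> s) (\<delta> t) = t - s" if "s \<in> {0..m}" "t \<in> {m..?d}" for s t
  proof -
    have "dist y (\<delta> s) = s" "dist (\<delta> t) (r z) = ?d - t"
      using same[of 0 s] same[of t ?d] d0 d1 that m by auto
    then show ?thesis
      using mixed[OF that] ge dist_triangle[of y "r z" "\<delta> s"] dist_triangle[of "\<delta> s" "r z" "\<delta> t"]
      by linarith
  qed
  have "geod_on \<delta> 0 ?d"
    unfolding geod_on_def
  proof (intro ballI)
    fix s t assume st: "s \<in> {0..?d}" "t \<in> {0..?d}"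
    consider "s \<le> m \<and> t \<le> m \<or> m \<le> s \<and> m \<le> t" | "s \<le> m" "m \<le> t" | "t \<le> m" "m \<le> s" by linarith
    then show "dist (\<delta> s) (\<delta> t) = \<bar>s - t\<bar>"
    proof cases
      case 1 then show ?thesis using same st by blast
    next
      case 2 then show ?thesis using mixed'[of s t] st by auto
    next
      case 3 then show ?thesis using mixed'[of t s] st by (auto simp: dist_commute)
    qed
  qed
  moreover have "r z \<in> P" using sidesD(10)[OF s z] .
  ultimately have "\<delta> m \<in> P"
    using geod_convexD[of P \<delta> 0 ?d m] sidesD(7)[OF s] y m d0 d1 by simp
  moreover have "\<delta> m \<in> fixset r" using m by (simp add: \<delta>_def fixset_def)
  ultimately show False using sidesD(3)[OF s] by blast
qed

section \<open>Reflection groups and words\<close>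

lemma gen_group_comp: "f \<in> gen_group G \<Longrightarrow> h \<in> gen_group G \<Longrightarrow> f \<circ> h \<in> gen_group G"
  by (induction rule: gen_group.induct) (auto simp: comp_assoc intro: gen_group.intros)

lemma gen_group_isometry:
  assumes "\<forall>g\<in>G. reflection g" "f \<in> gen_group G"
  shows "isometry f"
  using assms(2)
proof (induction rule: gen_group.induct)
  case gen_id
  show ?case by (rule isometry_id)
next
  case (gen_mult g f)
  then show ?case using assms(1) isometry_comp reflection_isometry by blast
next
  case (gen_inv g f)
  then show ?case using assms(1) isometry_comp isometry_inv reflection_isometry by blast
qed

lemma gen_group_inv:
  assumes "\<forall>g\<in>G. reflection g" "f \<in> gen_group G"
  shows "inv f \<in> gen_group G"
  using assms(2)
proof (induction rule: gen_group.induct)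
  case gen_id show ?case using gen_group.gen_id by (metis inv_id)
next
  have gin: "g \<in> gen_group G" if "g \<in> G" for g
    using gen_group.gen_mult[OF that gen_group.gen_id] by simp
  case (gen_mult g f)
  have "reflection g" using assms(1) gen_mult by blast
  then have "inv (g \<circ> f) = inv f \<circ> g"
    using o_inv_distrib[of g f] reflection_inv isometry_bij reflection_isometry
      gen_group_isometry[OF assms(1)] gen_mult by metis
  then show ?case using gen_group_comp gin gen_mult by metis
next
  have gin: "g \<in> gen_group G" if "g \<in> G" for g
    using gen_group.gen_mult[OF that gen_group.gen_id] by simp
  case (gen_inv g f)
  have "reflection g" using assms(1) gen_inv by blast
  then have "inv (inv g \<circ> f) = inv f \<circ> g"
    using o_inv_distrib[of g f] reflection_inv isometry_bij reflection_isometry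
      gen_group_isometry[OF assms(1)] gen_inv by metis
  then show ?case using gen_group_comp gin gen_inv by metis
qed

lemma word_prod_Nil [simp]: "word_prod [] = id"
  by (simp add: word_prod_def fun_eq_iff)

lemma word_prod_Cons [simp]: "word_prod (s # ss) = s \<circ> word_prod ss"
  by (simp add: word_prod_def fun_eq_iff)

lemma word_prod_append [simp]: "word_prod (ss @ ts) = word_prod ss \<circ> word_prod ts"
  by (induction ss) (auto simp: comp_assoc)

lemma word_length_le:
  assumes "set ss \<subseteq> S" shows "word_length S (word_prod ss) \<le> length ss"
  unfolding word_length_def by (rule Least_le) (use assms in blast)

text \<open>The \<open>LEAST\<close> in \<open>word_length\<close> is attained once some word
  represents w, hence the premise; for elements of \<open>W\<close> it comes from
  \<open>W_word\<close>.\<close>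

lemma word_length_word:
  assumes "set ss \<subseteq> S" "word_prod ss = w"
  obtains ts where "set ts \<subseteq> S" "word_prod ts = w" "length ts = word_length S w"
proof -
  have "\<exists>n ts. length ts = n \<and> set ts \<subseteq> S \<and> word_prod ts = w" using assms by blast
  from LeastI_ex[OF this] show ?thesis using that unfolding word_length_def by blast
qed

section \<open>Chambers\<close>

locale reflection_chamber =
  fixes W :: "('a::metric_space \<Rightarrow> 'a) set" and C :: "'a set" and S :: "('a \<Rightarrow> 'a) set" and x0 :: 'a
  assumes cat: "CAT0 TYPE('a)"
    and refl_group: "reflection_group W"
    and proper: "acts_properly W"
    and chamber: "chamber W C"
    and cocompact: "cocompact_discrete W C"
    and minimal: "minimal_generating W C S"
    and x0: "x0 \<in> C"
begin

abbreviation R :: "('a \<Rightarrow> 'a) set" where "R \<equiv> reflections_in W"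

abbreviation walls :: "'a set" where "walls \<equiv> \<Union>r\<in>R. fixset r"

abbreviation pos :: "('a \<Rightarrow> 'a) \<Rightarrow> 'a set" where "pos r \<equiv> half_plus r C"

abbreviation neg :: "('a \<Rightarrow> 'a) \<Rightarrow> 'a set" where "neg r \<equiv> r ` pos r"

section \<open>The action of W on walls and chambers\<close>

lemma W_id: "id \<in> W"
  using refl_group gen_group.gen_id unfolding reflection_group_def by blast

lemma W_comp: "u \<in> W \<Longrightarrow> v \<in> W \<Longrightarrow> u \<circ> v \<in> W"
  using refl_group gen_group_comp unfolding reflection_group_def by blast

lemma W_inv: "u \<in> W \<Longrightarrow> inv u \<in> W"
  using refl_group gen_group_inv unfolding reflection_group_def by blast

lemma W_isometry: "u \<in> W \<Longrightarrow> isometry u"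
  using refl_group gen_group_isometry unfolding reflection_group_def by blast

lemma R_W: "r \<in> R \<Longrightarrow> r \<in> W" and R_reflection: "r \<in> R \<Longrightarrow> reflection r"
  by (simp_all add: reflections_in_def)

lemma S_R: "s \<in> S \<Longrightarrow> s \<in> R"
  using minimal unfolding minimal_generating_def by blast

lemma C_eq: "C = (\<Inter>s\<in>S. pos s)"
  using minimal unfolding minimal_generating_def by blast

lemma conj_R: "r \<in> R \<Longrightarrow> u \<in> W \<Longrightarrow> u \<circ> r \<circ> inv u \<in> R"
  by (simp add: reflections_in_def reflection_conj(1) W_comp W_inv W_isometry)

lemma image_walls: assumes u: "u \<in> W" shows "u ` walls = walls"
proof -
  have sub: "v ` walls \<subseteq> walls" if v: "v \<in> W" for v
  proof -
    have "v ` fixset r \<subseteq> walls" if "r \<in> R" for r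
      using conj_R[OF that v] reflection_conj(2)[OF R_reflection[OF that] W_isometry[OF v]] by blast
    then show ?thesis by blast
  qed
  have "u ` inv u ` walls \<subseteq> u ` walls" using sub[OF W_inv[OF u]] by (rule image_mono)
  then have "walls \<subseteq> u ` walls"
    by (simp only: image_image isometry_f_inv[OF W_isometry[OF u]] image_ident)
  with sub[OF u] show ?thesis by blast
qed

lemma C_component: "C \<in> components (- walls)"
  using chamber unfolding chamber_def by (simp add: Compl_eq_Diff_UNIV)

lemma connected_C: "connected C"
  using C_component in_components_connected by blast

lemma image_C_component:
  assumes u: "u \<in> W" shows "u ` C \<in> components (- walls)"
proof -
  have "u ` (- walls) = - walls"
    using bij_image_Compl_eq[OF isometry_bij[OF W_isometry[OF u]]] image_walls[OF u] by metis
  then show ?thesis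
    using isometry_components_image[OF W_isometry[OF u], of "- walls"] C_component
    by (metis imageI)
qed

text \<open>Overlapping translates of C are the same component, and the stabiliser of C is trivial.
  Equalities in \<open>W\<close> are later obtained by finding a common point of two
  chambers.\<close>

lemma chambers_disjoint:
  assumes "u \<in> W" "v \<in> W" "u ` C \<inter> v ` C \<noteq> {}"
  shows "u = v"
proof -
  note iso = W_isometry[OF assms(2)]
  have "u ` C = v ` C"
    using components_nonoverlap[OF image_C_component image_C_component] assms by blast
  then have "(inv v \<circ> u) ` C = C"
    by (simp only: image_comp[symmetric]) (simp add: image_image isometry_inv_f[OF iso])
  then have "inv v \<circ> u = id"
    using cocompact W_comp[OF W_inv] assms(1,2) unfolding cocompact_discrete_def by blast
  then have "v (inv v (u x)) = v x" for x by (metis comp_apply id_apply)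
  then show "u = v" by (simp add: isometry_f_inv[OF iso] fun_eq_iff)
qed

lemma chamber_off_wall:
  assumes "u \<in> W" "r \<in> R" shows "u ` C \<inter> fixset r = {}"
  using in_components_subset[OF image_C_component[OF assms(1)]] assms(2) by blast

lemma orbit_off_wall: "u \<in> W \<Longrightarrow> r \<in> R \<Longrightarrow> u x0 \<notin> fixset r"
  using chamber_off_wall x0 by blast

lemma sides_R: assumes "r \<in> R" shows "sides r (pos r) (neg r)" "C \<subseteq> pos r"
  using sides_half_plus[OF R_reflection[OF assms] connected_C] x0 chamber_off_wall[OF W_id assms]
  by auto

lemma x0_pos: "r \<in> R \<Longrightarrow> x0 \<in> pos r"
  using sides_R(2) x0 by blast

text \<open>A chamber is connected and misses every wall, so its base point \<open>u x0\<close>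
  decides on which side all of it lies.\<close>

lemma chamber_pos:
  assumes "u \<in> W" "r \<in> R" "u x0 \<in> pos r" shows "u ` C \<subseteq> pos r"
proof
  fix y assume y: "y \<in> u ` C"
  have "connected (u ` C)"
    using connected_C W_isometry[OF assms(1)] connected_continuous_image isometry_continuous_on by blast
  then show "y \<in> pos r"
    using sides_crossing[OF sides_R(1)[OF assms(2)] _ _ assms(3) y] chamber_off_wall[OF assms(1,2)] x0
    by blast
qed

lemma chamber_neg:
  assumes "u \<in> W" "r \<in> R" "u x0 \<notin> pos r" shows "u ` C \<subseteq> neg r"
proof
  fix y assume y: "y \<in> u ` C"
  have c: "connected (u ` C)"
    using connected_C W_isometry[OF assms(1)] connected_continuous_image isometry_continuous_on by blast
  have "y \<notin> pos r"
    using sides_crossing[OF sides_R(1)[OF assms(2)] c y _ _ assms(3)] chamber_off_wall[OF assms(1,2)] x0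
    by blast
  then show "y \<in> neg r"
    using sides_iff[OF sides_R(1)[OF assms(2)]] y chamber_off_wall[OF assms(1,2)] by blast
qed

text \<open>The opposite half-space is open, so a closed chamber can touch it only along the wall.
  With \<open>closure_chamber_neg\<close>, a point common to closed chambers on opposite sides lies
  on the wall.\<close>

lemma closure_chamber_pos:
  assumes "u \<in> W" "r \<in> R" "u x0 \<in> pos r" "z \<in> closure (u ` C)" shows "z \<notin> neg r"
proof -
  note s = sides_R(1)[OF assms(2)]
  have "u ` C \<subseteq> - neg r" using chamber_pos[OF assms(1-3)] sidesD(4)[OF s] by blast
  then have "closure (u ` C) \<subseteq> - neg r"
    using sidesD(6)[OF s] by (intro closure_minimal) auto
  then show ?thesis using assms(4) by blast
qed

lemma closure_chamber_neg:
  assumes "u \<in> W" "r \<in> R" "u x0 \<notin> pos r" "z \<in> closure (u ` C)" shows "z \<notin> pos r"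
proof -
  note s = sides_R(1)[OF assms(2)]
  have "u ` C \<subseteq> - pos r" using chamber_neg[OF assms(1-3)] sidesD(4)[OF s] by blast
  then have "closure (u ` C) \<subseteq> - pos r"
    using sidesD(5)[OF s] by (intro closure_minimal) auto
  then show ?thesis using assms(4) by blast
qed

lemma word_W: "set ss \<subseteq> S \<Longrightarrow> word_prod ss \<in> W"
proof (induction ss)
  case Nil
  show ?case using W_id by (simp only: word_prod_Nil)
next
  case (Cons s ss)
  then have "s \<in> W" "word_prod ss \<in> W" using R_W S_R by simp_all
  then show ?case unfolding word_prod_Cons by (rule W_comp)
qed

section \<open>Local finiteness, and generation of W by S\<close>

lemma finite_orbit_ball: "finite {u \<in> W. dist y (u x) \<le> M}"
proof (rule finite_subset)
  have "dist x y + \<bar>M\<bar> + 1 > 0" by (smt (verit) zero_le_dist)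
  then show "finite {u \<in> W. u x \<in> ball x (dist x y + \<bar>M\<bar> + 1)}"
    using proper unfolding acts_properly_def by blast
  show "{u \<in> W. dist y (u x) \<le> M} \<subseteq> {u \<in> W. u x \<in> ball x (dist x y + \<bar>M\<bar> + 1)}"
  proof
    fix u assume "u \<in> {u \<in> W. dist y (u x) \<le> M}"
    then show "u \<in> {u \<in> W. u x \<in> ball x (dist x y + \<bar>M\<bar> + 1)}"
      using dist_triangle[of x "u x" y] by auto
  qed
qed

text \<open>A reflection fixing a point within e of x moves x by at most 2e, and properness leaves
  finitely many such elements.\<close>

lemma finite_walls_ball: "finite {r \<in> R. fixset r \<inter> ball x e \<noteq> {}}"
proof (rule finite_subset)
  show "finite {u \<in> W. dist x (u x) \<le> 2 * e}" by (rule finite_orbit_ball)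
  show "{r \<in> R. fixset r \<inter> ball x e \<noteq> {}} \<subseteq> {u \<in> W. dist x (u x) \<le> 2 * e}"
  proof
    fix r assume r: "r \<in> {r \<in> R. fixset r \<inter> ball x e \<noteq> {}}"
    then obtain y where y: "r y = y" "dist x y < e" by (auto simp: fixset_def)
    have "dist (r x) (r y) = dist x y" using r isometry_dist W_isometry R_W by blast
    then have "dist x (r x) \<le> 2 * e"
      using y dist_triangle[of x "r x" y] by (simp add: dist_commute)
    then show "r \<in> {u \<in> W. dist x (u x) \<le> 2 * e}" using r R_W by blast
  qed
qed

text \<open>The orbit point of \<open>x0\<close> under the group generated by \<open>S\<close> that is closest to \<open>y\<close> cannot be
  separated from \<open>y\<close> by a wall of its own chamber, for otherwise reflecting it in that wall would
  move it closer.\<close>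

lemma off_walls_in_chamber:
  assumes y: "y \<notin> walls"
  obtains ss where "set ss \<subseteq> S" "y \<in> word_prod ss ` C"
proof -
  \<comment> \<open>The minimum is taken over products of words in S, not over \<open>W\<close>: the
    chamber found then comes with a word, from which \<open>W_word\<close> deduces that S generates
    \<open>W\<close>.\<close>
  define G where "G = word_prod ` {ss. set ss \<subseteq> S}"
  have GW: "G \<subseteq> W" unfolding G_def using word_W by blast
  have idG: "id \<in> G" unfolding G_def by (intro image_eqI[of _ _ "[]"]) simp_all
  \<comment> \<open>Outside F the orbit points are farther from y than \<open>x0\<close> is, so a
    minimum over the finite set F is one over G.\<close>
  define F where "F = {u \<in> G. dist y (u x0) \<le> dist y x0}"
  have "finite F"
    by (rule finite_subset[OF _ finite_orbit_ball[of y x0 "dist y x0"]]) (use GW F_def in blast)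
  moreover have "F \<noteq> {}" using idG unfolding F_def by auto
  ultimately obtain u where u: "is_arg_min (\<lambda>u. dist y (u x0)) (\<lambda>u. u \<in> F) u"
    using ex_is_arg_min_if_finite by blast
  then have uG: "u \<in> G" and uF: "dist y (u x0) \<le> dist y x0" by (auto simp: is_arg_min_def F_def)
  have least: "dist y (u x0) \<le> dist y (v x0)" if "v \<in> G" for v
    using u uF that by (fastforce simp: is_arg_min_linorder F_def)
  have uW: "u \<in> W" using uG GW by blast
  define z where "z = inv u y"
  have uz: "u z = y" by (simp add: z_def isometry_f_inv W_isometry uW)
  have "z \<in> pos s" if s: "s \<in> S" for s
  proof (rule ccontr)
    assume "z \<notin> pos s"
    moreover have "z \<notin> walls"
    proof
      assume "z \<in> walls"
      then have "u z \<in> u ` walls" by blast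
      then show False using y uz image_walls[OF uW] by simp
    qed
    ultimately have zn: "z \<in> neg s"
      using sides_iff[OF sides_R(1)] S_R[OF s] by blast
    note si = sides_R(1)[OF S_R[OF s]]
    have "s (s x0) = x0" using reflection_invol[OF sidesD(1)[OF si]] .
    then have "dist z (s x0) < dist z x0"
      using dist_reflect_less[OF cat sides_sym[OF si] zn x0_pos[OF S_R[OF s]]] by simp
    then have "dist (u z) (u (s x0)) < dist (u z) (u x0)"
      by (simp add: isometry_dist W_isometry uW)
    moreover have "u \<circ> s \<in> G"
    proof -
      obtain ss where "set ss \<subseteq> S" "u = word_prod ss" using uG unfolding G_def by blast
      then show ?thesis unfolding G_def using s by (intro image_eqI[of _ _ "ss @ [s]"]) simp_all
    qed
    ultimately show False using least[of "u \<circ> s"] uz by simp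
  qed
  then have "z \<in> C" using C_eq by blast
  then show ?thesis using that uG uz unfolding G_def by blast
qed

text \<open>The point \<open>w x0\<close> is off the walls, hence in a chamber given by a word; this
  chamber shares a point with that of w.\<close>

lemma W_word:
  assumes "w \<in> W" obtains ss where "set ss \<subseteq> S" "word_prod ss = w"
proof -
  have "w x0 \<notin> walls" using orbit_off_wall assms by blast
  then obtain ss where ss: "set ss \<subseteq> S" "w x0 \<in> word_prod ss ` C" by (rule off_walls_in_chamber)
  then have "word_prod ss = w"
    using chambers_disjoint[OF word_W[OF ss(1)] assms] x0 by blast
  then show ?thesis using that ss by blast
qed

text \<open>Only finitely many walls meet the ball, and a finite union of closed sets with empty
  interior has empty interior.\<close>

lemma off_walls_dense:
  assumes "e > 0" obtains y where "y \<in> ball x e" "y \<notin> walls"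
proof -
  let ?F = "{r \<in> R. fixset r \<inter> ball x e \<noteq> {}}"
  have fin: "finite G \<Longrightarrow> G \<subseteq> R \<Longrightarrow> closed (\<Union>r\<in>G. fixset r) \<and> interior (\<Union>r\<in>G. fixset r) = {}" for G
  proof (induction rule: finite_induct)
    case empty then show ?case by simp
  next
    case (insert r G)
    have r: "reflection r" using R_reflection insert by blast
    have "closed (fixset r)" using closed_fixset reflection_isometry r by blast
    moreover have "interior (fixset r) = {}" using r by (simp add: reflection_def)
    ultimately show ?case
      using insert interior_closed_Un_empty_interior[of "fixset r" "\<Union>r\<in>G. fixset r"]
      by (simp add: closed_Un)
  qed
  have "interior (\<Union>r\<in>?F. fixset r) = {}" using fin[OF finite_walls_ball] by blast
  then have "\<not> ball x e \<subseteq> (\<Union>r\<in>?F. fixset r)"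
    using interior_maximal[OF _ open_ball, of x e] centre_in_ball[of x e] assms by blast
  then obtain y where y: "y \<in> ball x e" "y \<notin> (\<Union>r\<in>?F. fixset r)" by blast
  then have "y \<notin> walls" by blast
  then show ?thesis using that y by blast
qed

lemma bounded_closure_C: "bounded (closure C)"
  using cocompact compact_imp_bounded unfolding cocompact_discrete_def by blast

lemma closure_C_diameter: "x \<in> closure C \<Longrightarrow> y \<in> closure C \<Longrightarrow> dist x y \<le> diameter (closure C)"
  using diameter_bounded_bound[OF bounded_closure_C] .

text \<open>Points off the walls approach z. Their chambers have base points within 1 + diam of z,
  so finitely many chambers suffice, and closure commutes with finite unions.\<close>

lemma in_closure_chamber:
  obtains ss where "set ss \<subseteq> S" "z \<in> closure (word_prod ss ` C)"
proof -
  define U where "U = {u \<in> W. dist z (u x0) \<le> 1 + diameter (closure C)}"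
  have U: "finite U" unfolding U_def by (rule finite_orbit_ball)
  have "z \<in> closure (\<Union>u\<in>U. u ` C)"
    unfolding closure_approachable
  proof (intro allI impI)
    fix e :: real assume "e > 0"
    then obtain y where y: "y \<in> ball z (min e 1)" "y \<notin> walls"
      using off_walls_dense[of "min e 1" z] by auto
    obtain ss c where ss: "set ss \<subseteq> S" "y = word_prod ss c" "c \<in> C"
      using off_walls_in_chamber[OF y(2)] by blast
    have "dist y (word_prod ss x0) \<le> diameter (closure C)"
      unfolding ss(2) isometry_dist[OF W_isometry[OF word_W[OF ss(1)]]]
      using ss(3) x0 closure_subset by (intro closure_C_diameter) blast+
    then have "word_prod ss \<in> U"
      using y(1) word_W[OF ss(1)] dist_triangle[of z "word_prod ss x0" y] by (simp add: U_def)
    then show "\<exists>y\<in>\<Union>u\<in>U. u ` C. dist y z < e"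
      using y(1) ss by (intro bexI[of _ y]) (auto simp: dist_commute)
  qed
  also have "closure (\<Union>u\<in>U. u ` C) = (\<Union>u\<in>U. closure (u ` C))"
    using U by induction auto
  finally obtain u where u: "u \<in> U" "z \<in> closure (u ` C)" by blast
  then obtain ss where "set ss \<subseteq> S" "word_prod ss = u" using W_word unfolding U_def by blast
  then show ?thesis using that u by blast
qed

text \<open>The bound is uniform in \<open>s\<close> because only finitely many walls meet a given ball.\<close>

lemma common_radius:
  obtains e where "e > 0" "\<And>s. s \<in> R \<Longrightarrow> z \<in> pos s \<Longrightarrow> ball z e \<subseteq> pos s"
proof -
  let ?F = "{r \<in> R. fixset r \<inter> ball z 1 \<noteq> {} \<and> z \<in> pos r}"
  have "finite ?F" by (rule finite_subset[OF _ finite_walls_ball[of z 1]]) blast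
  then have "open (\<Inter>r\<in>?F. pos r)" using sidesD(5)[OF sides_R(1)] by (intro open_INT) auto
  moreover have "z \<in> (\<Inter>r\<in>?F. pos r)" by blast
  ultimately obtain e where e: "e > 0" "ball z e \<subseteq> (\<Inter>r\<in>?F. pos r)" by (rule openE)
  have "ball z (min e 1) \<subseteq> pos s" if s: "s \<in> R" "z \<in> pos s" for s
  proof (cases "s \<in> ?F")
    case True
    then have "ball z e \<subseteq> pos s" using e(2) by blast
    moreover have "ball z (min e 1) \<subseteq> ball z e" by (simp add: subset_ball)
    ultimately show ?thesis by blast
  next
    \<comment> \<open>As z is in \<open>pos s\<close>, the wall of s misses the unit ball here, and
      a geodesic inside that ball cannot cross it.\<close>
    case False
    show ?thesis
    proof
      fix y assume y: "y \<in> ball z (min e 1)"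
      obtain \<gamma> where \<gamma>: "\<gamma> 0 = z" "\<gamma> (dist z y) = y" "geod_on \<gamma> 0 (dist z y)"
        using CAT0_geodesic[OF cat] .
      have "\<gamma> ` {0..dist z y} \<subseteq> ball z 1"
      proof
        fix p assume "p \<in> \<gamma> ` {0..dist z y}"
        then obtain t where t: "t \<in> {0..dist z y}" "p = \<gamma> t" by blast
        then have "dist z p = t" using geod_on_dist[OF \<gamma>(3), of 0 t] \<gamma>(1) by simp
        then show "p \<in> ball z 1" using t y by simp
      qed
      then have "\<gamma> ` {0..dist z y} \<inter> fixset s = {}" using False s by blast
      moreover have "z \<in> \<gamma> ` {0..dist z y}" using \<gamma>(1) by (intro image_eqI[of _ _ 0]) auto
      moreover have "y \<in> \<gamma> ` {0..dist z y}" using \<gamma>(2) by (intro image_eqI[of _ _ "dist z y"]) auto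
      ultimately show "y \<in> pos s"
        using sides_crossing[OF sides_R(1)[OF s(1)] geod_on_connected[OF \<gamma>(3)]] s(2) by blast
    qed
  qed
  then show ?thesis using that[of "min e 1"] e(1) by simp
qed

section \<open>Crossing the wall of a generator\<close>

text \<open>Minimality of S yields a point z of the wall of s strictly inside the half-spaces of all
  other generators. Off the wall of s, only the chambers of id and s occur near z. Since r fixes z
  too, the chamber of r occurs there and must be that of s.\<close>

lemma reflection_eq_generator:
  assumes s: "s \<in> S" and r: "r \<in> R" and sep: "s x0 \<notin> pos r"
  shows "r = s"
proof -
  note sW = R_W[OF S_R[OF s]] and rW = R_W[OF r]
  note ss = sides_R(1)[OF S_R[OF s]] and sr = sides_R(1)[OF r]
  have "S - {s} \<subset> S" using s by blast
  then have "C \<noteq> (\<Inter>t\<in>S - {s}. pos t)"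
    using minimal unfolding minimal_generating_def by blast
  moreover have "C \<subseteq> (\<Inter>t\<in>S - {s}. pos t)" using C_eq by blast
  ultimately obtain y where y: "\<And>t. t \<in> S \<Longrightarrow> t \<noteq> s \<Longrightarrow> y \<in> pos t" "y \<notin> C" by blast
  then have ys: "y \<notin> pos s" using C_eq by blast
  obtain \<gamma> where \<gamma>: "\<gamma> 0 = x0" "\<gamma> (dist x0 y) = y" "geod_on \<gamma> 0 (dist x0 y)"
    using CAT0_geodesic[OF cat] .
  have "\<gamma> ` {0..dist x0 y} \<inter> fixset s \<noteq> {}"
  proof (rule sides_crossing[OF ss geod_on_connected[OF \<gamma>(3)] _ x0_pos[OF S_R[OF s]] _ ys])
    show "x0 \<in> \<gamma> ` {0..dist x0 y}" using \<gamma>(1) by (intro image_eqI[of _ _ 0]) auto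
    show "y \<in> \<gamma> ` {0..dist x0 y}" using \<gamma>(2) by (intro image_eqI[of _ _ "dist x0 y"]) auto
  qed
  then obtain z \<tau> where z: "z \<in> fixset s" "z = \<gamma> \<tau>" "\<tau> \<in> {0..dist x0 y}" by blast
  have zt: "z \<in> pos t" if "t \<in> S" "t \<noteq> s" for t
    using geod_convexD[OF sidesD(7)[OF sides_R(1)[OF S_R[OF that(1)]]] \<gamma>(3), of \<tau>] z
      x0_pos[OF S_R[OF that(1)]] y(1)[OF that] \<gamma>(1,2) by simp
  obtain e where e: "e > 0" "\<And>t. t \<in> R \<Longrightarrow> z \<in> pos t \<Longrightarrow> ball z e \<subseteq> pos t"
    using common_radius[of z] by blast
  have ball_C: "b \<in> C" if "b \<in> ball z e" "b \<in> pos s" for b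
    using that e(2) zt S_R C_eq by blast
  have sz: "s z = z" using z(1) by (simp add: fixset_def)
  have ball_s: "s b \<in> ball z d" if "b \<in> ball z d" for b d
    using that isometry_dist[OF sidesD(2)[OF ss], of z b] sz by simp
  have ball_sC: "b \<in> s ` C" if "b \<in> ball z e" "b \<in> neg s" for b
    using ball_C[OF ball_s[OF that(1)] sidesD(10)[OF ss that(2)]]
      reflection_invol[OF sidesD(1)[OF ss], of b] by (metis image_eqI)
  have zC: "z \<in> closure C"
    unfolding closure_approachable
  proof (intro allI impI)
    fix d :: real assume d: "d > 0"
    \<comment> \<open>The wall has empty interior, so points off it occur arbitrarily near z; one on
      the wrong side is reflected by s, which fixes z.\<close>
    have "interior (fixset s) = {}" using sidesD(1)[OF ss] by (simp add: reflection_def)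
    then have "\<not> ball z (min d e) \<subseteq> fixset s"
      using interior_maximal[OF _ open_ball, of z "min d e" "fixset s"] centre_in_ball[of z "min d e"] d e(1)
      by auto
    then obtain b where b: "b \<in> ball z (min d e)" "b \<notin> fixset s" by blast
    obtain c where c: "c \<in> ball z (min d e)" "c \<in> pos s"
    proof (cases "b \<in> pos s")
      case True
      then show ?thesis using that b by blast
    next
      case False
      then have "b \<in> neg s" using b(2) sides_iff[OF ss] by blast
      then show ?thesis using that[OF ball_s[OF b(1)] sidesD(10)[OF ss]] by blast
    qed
    then have "c \<in> C" "dist c z < d" using ball_C[of c] by (auto simp: dist_commute)
    then show "\<exists>c\<in>C. dist c z < d" by blast
  qed
  \<comment> \<open>Now z is in the closures of C and of its image under s, which lie on opposite
    sides of r; so z is on the wall of r.\<close>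
  have "z \<in> closure (s ` C)"
    using zC sz isometry_closure_image[OF sidesD(2)[OF ss], of C] by (metis image_eqI)
  then have "z \<notin> pos r" using closure_chamber_neg[OF sW r sep] by blast
  moreover have "z \<notin> neg r" using closure_chamber_pos[OF W_id r] x0_pos[OF r] zC by simp
  ultimately have "r z = z" using sides_iff[OF sr, of z] by (simp add: fixset_def)
  then have "z \<in> closure (r ` C)"
    using zC isometry_closure_image[OF sidesD(2)[OF sr], of C] by (metis image_eqI)
  then obtain b where b: "b \<in> r ` C" "b \<in> ball z e"
    using e(1) unfolding closure_approachable by (metis dist_commute mem_ball)
  have "b \<notin> fixset s" using b(1) chamber_off_wall[OF rW S_R[OF s]] by blast
  then consider "b \<in> pos s" | "b \<in> neg s" using sides_iff[OF ss, of b] by blast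
  then show ?thesis
  proof cases
    case 1
    then have "r ` C \<inter> id ` C \<noteq> {}" using ball_C b by auto
    then have "r = id" using chambers_disjoint rW W_id by blast
    then have "x0 \<in> fixset r" by (simp add: fixset_def)
    then show ?thesis using orbit_off_wall[OF W_id r] by simp
  next
    case 2
    then have "r ` C \<inter> s ` C \<noteq> {}" using ball_sC b by blast
    then show ?thesis using chambers_disjoint rW sW by blast
  qed
qed

text \<open>The folding argument: the gallery of the word crosses the wall of \<open>s\<close> between two
  consecutive chambers, whose common wall must then be this one.\<close>

lemma word_deletion:
  assumes s: "s \<in> S"
  shows "set ss \<subseteq> S \<Longrightarrow> word_prod ss x0 \<notin> pos s \<Longrightarrow>
    \<exists>ts. set ts \<subseteq> S \<and> Suc (length ts) = length ss \<and> word_prod ts = s \<circ> word_prod ss"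
proof (induction ss rule: rev_induct)
  case Nil
  then show ?case using x0_pos[OF S_R[OF s]] by simp
next
  case (snoc t us)
  let ?u = "word_prod us"
  have t: "t \<in> S" and us: "set us \<subseteq> S" using snoc.prems by auto
  note uW = word_W[OF us] and tW = R_W[OF S_R[OF t]]
  show ?case
  proof (cases "?u x0 \<in> pos s")
    \<comment> \<open>The prefix already ends beyond the wall, so a letter is deleted within
      it.\<close>
    case False
    then obtain vs where "set vs \<subseteq> S" "Suc (length vs) = length us" "word_prod vs = s \<circ> ?u"
      using snoc.IH us by blast
    then show ?thesis using t by (intro exI[of _ "vs @ [t]"]) (auto simp: comp_assoc)
  next
    case True
    \<comment> \<open>The wall of s separates the images of C and \<open>t\<close> C\<open>under the
      prefix product; pulled back, it becomes the wall of r, separating C from\<close>t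
      \<open>C\<close>.\<close>
    define r where "r = inv ?u \<circ> s \<circ> ?u"
    have iso: "isometry ?u" using uW W_isometry by blast
    have "inv (inv ?u) = ?u" using iso isometry_bij inv_inv_eq by blast
    then have rR: "r \<in> R" using conj_R[OF S_R[OF s] W_inv[OF uW]] by (simp add: r_def)
    have fix_r: "?u ` fixset r \<subseteq> fixset s"
    proof
      fix y assume "y \<in> ?u ` fixset r"
      then obtain x where x: "y = ?u x" "inv ?u (s (?u x)) = x" by (auto simp: fixset_def r_def)
      then have "s (?u x) = ?u x" using isometry_f_inv[OF iso] by metis
      then show "y \<in> fixset s" by (simp add: fixset_def x(1))
    qed
    \<comment> \<open>Otherwise the geodesic from \<open>x0\<close> to \<open>t x0\<close> stays in
      the convex set \<open>pos r\<close>, although its image under the prefix has to cross the wall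
      of s.\<close>
    have "t x0 \<notin> pos r"
    proof
      assume tr: "t x0 \<in> pos r"
      obtain \<gamma> where \<gamma>: "\<gamma> 0 = x0" "\<gamma> (dist x0 (t x0)) = t x0" "geod_on \<gamma> 0 (dist x0 (t x0))"
        using CAT0_geodesic[OF cat] .
      let ?T = "(?u \<circ> \<gamma>) ` {0..dist x0 (t x0)}"
      have "?u x0 \<in> ?T" using \<gamma>(1) by (intro image_eqI[of _ _ 0]) auto
      moreover have "?u (t x0) \<in> ?T"
        using \<gamma>(2) by (intro image_eqI[of _ _ "dist x0 (t x0)"]) auto
      moreover have "?u (t x0) \<notin> pos s" using snoc.prems by simp
      ultimately have "?T \<inter> fixset s \<noteq> {}"
        using sides_crossing[OF sides_R(1)[OF S_R[OF s]]
            geod_on_connected[OF geod_on_isometry[OF iso \<gamma>(3)]] _ True] by blast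
      then obtain \<tau> where \<tau>: "\<tau> \<in> {0..dist x0 (t x0)}" "s (?u (\<gamma> \<tau>)) = ?u (\<gamma> \<tau>)"
        unfolding fixset_def comp_apply by blast
      then have "\<gamma> \<tau> \<in> fixset r" by (simp add: fixset_def r_def isometry_inv_f[OF iso])
      moreover have "\<gamma> \<tau> \<in> pos r"
        using geod_convexD[OF sidesD(7)[OF sides_R(1)[OF rR]] \<gamma>(3) _ _ \<tau>(1)] \<gamma>(1,2) tr x0_pos[OF rR]
        by simp
      ultimately show False using sidesD(3)[OF sides_R(1)[OF rR]] by blast
    qed
    then have "r = t" by (rule reflection_eq_generator[OF t rR])
    \<comment> \<open>Writing u for the prefix product, r = t reads u t = s u, so multiplying by s
      cancels the last letter.\<close>
    then have "?u (t x) = s (?u x)" for x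
      using isometry_f_inv[OF iso] by (auto simp: r_def)
    then have "s (?u (t x)) = ?u x" for x
      using reflection_invol[OF R_reflection[OF S_R[OF s]]] by simp
    then have "word_prod us = s \<circ> word_prod (us @ [t])" by (simp add: fun_eq_iff)
    moreover have "Suc (length us) = length (us @ [t])" by simp
    ultimately show ?thesis using us by blast
  qed
qed

section \<open>The closed chamber and the gallery along a geodesic\<close>

text \<open>For the converse take a shortest word whose closed chamber contains z. If it began with
  s, that chamber would lie beyond the wall of s, so z would be on this wall and reflecting would
  drop s. Hence the word is empty.\<close>

lemma closure_C_iff: "z \<in> closure C \<longleftrightarrow> (\<forall>s\<in>S. z \<notin> neg s)"
proof
  assume "z \<in> closure C"
  then show "\<forall>s\<in>S. z \<notin> neg s"
    using closure_chamber_pos[OF W_id S_R] x0_pos[OF S_R] by simp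
next
  assume z: "\<forall>s\<in>S. z \<notin> neg s"
  define Q where "Q ss \<longleftrightarrow> set ss \<subseteq> S \<and> z \<in> closure (word_prod ss ` C)" for ss
  have "\<exists>ss. Q ss" using in_closure_chamber[of z] unfolding Q_def by metis
  then obtain ss where ss: "Q ss" "\<And>ts. Q ts \<Longrightarrow> length ss \<le> length ts"
    by (metis ex_has_least_nat)
  show "z \<in> closure C"
  proof (cases ss)
    case Nil
    then show ?thesis using ss(1) by (simp add: Q_def)
  next
    case (Cons s us)
    let ?u = "word_prod us"
    have s: "s \<in> S" and us: "set us \<subseteq> S" using ss(1) Cons by (auto simp: Q_def)
    have zs: "z \<in> closure ((s \<circ> ?u) ` C)" using ss(1) Cons by (simp add: Q_def)
    note si = sides_R(1)[OF S_R[OF s]]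
    note suW = W_comp[OF R_W[OF S_R[OF s]] word_W[OF us]]
    \<comment> \<open>On the positive side, \<open>us\<close> alone would end beyond the wall, and
      deletion would express \<open>s \<circ> ?u\<close> with two letters fewer than
      \<open>ss\<close>.\<close>
    have "(s \<circ> ?u) x0 \<notin> pos s"
    proof
      assume "(s \<circ> ?u) x0 \<in> pos s"
      then have "s (s (?u x0)) \<in> neg s" by (simp add: sidesD(9)[OF si])
      then have "?u x0 \<notin> pos s"
        using sides_iff[OF si] reflection_invol[OF sidesD(1)[OF si]] by metis
      then obtain ts where ts: "set ts \<subseteq> S" "Suc (length ts) = length us" "word_prod ts = s \<circ> ?u"
        using word_deletion[OF s us] by blast
      then have "Q ts" using zs by (simp add: Q_def)
      then show False using ss(2)[of ts] ts(2) Cons by simp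
    qed
    then have "z \<notin> pos s" using closure_chamber_neg[OF suW S_R[OF s]] zs by blast
    then have "s z = z" using z s sides_iff[OF si, of z] by (auto simp: fixset_def)
    moreover have "s z \<in> closure (s ` (s \<circ> ?u) ` C)"
      using zs isometry_closure_image[OF sidesD(2)[OF si]] by blast
    moreover have "s ` (s \<circ> ?u) ` C = ?u ` C"
      by (simp add: image_image reflection_invol[OF sidesD(1)[OF si]])
    ultimately have "Q us" using us by (simp add: Q_def)
    then show ?thesis using ss(2)[of us] Cons by simp
  qed
qed

lemma closure_C_convex:
  assumes "geod_on \<gamma> a b" "\<gamma> a \<in> closure C" "\<gamma> b \<in> closure C" "t \<in> {a..b}"
  shows "\<gamma> t \<in> closure C"
  using closed_half_space_convex[OF cat sides_R(1)[OF S_R] assms(1) _ _ assms(4)] assms(2,3)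
  by (simp add: closure_C_iff)

text \<open>At the last time in the closed chamber the geodesic must sit on the wall of a generator that
  separates it from its endpoint, since the other closed half-spaces are not left immediately.\<close>

lemma leave_chamber:
  assumes v: "v \<in> W" "v \<noteq> id" and g: "geod_on \<gamma> a b" and ab: "a \<le> b"
    and ga: "\<gamma> a \<in> closure C" and gb: "\<gamma> b = v x0"
  obtains s \<tau> where "s \<in> S" "\<tau> \<in> {a..b}" "\<gamma> \<tau> \<in> closure C" "s (\<gamma> \<tau>) = \<gamma> \<tau>" "v x0 \<notin> pos s"
proof -
  define T where "T = {a..b} \<inter> \<gamma> -` closure C"
  have "closed T"
    unfolding T_def using continuous_closed_preimage[OF geod_on_continuous[OF g]] by simp
  then have "compact T" unfolding T_def by (metis compact_Int_closed compact_Icc inf.idem inf_assoc)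
  moreover have "T \<noteq> {}" unfolding T_def using ga ab by auto
  ultimately obtain \<tau> where \<tau>: "\<tau> \<in> T" "\<And>t. t \<in> T \<Longrightarrow> t \<le> \<tau>"
    using compact_attains_sup by metis
  then have \<tau>ab: "\<tau> \<in> {a..b}" and \<tau>C: "\<gamma> \<tau> \<in> closure C" by (auto simp: T_def)
  have "\<exists>s\<in>S. \<gamma> \<tau> \<in> fixset s \<and> v x0 \<notin> pos s"
  proof (rule ccontr)
    assume neg: "\<not> ?thesis"
    \<comment> \<open>The endpoint is off the walls, so in the closed chamber it would lie in C,
      forcing v to be the identity.\<close>
    have "\<tau> \<noteq> b"
    proof
      assume "\<tau> = b"
      then have "v x0 \<notin> neg s" if "s \<in> S" for s using \<tau>C gb closure_C_iff that by auto
      then have "v x0 \<in> pos s" if "s \<in> S" for s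
        using that sides_iff[OF sides_R(1)[OF S_R]] orbit_off_wall[OF v(1) S_R] by blast
      then have "v x0 \<in> C" using C_eq by blast
      then have "v ` C \<inter> id ` C \<noteq> {}" using x0 by auto
      then show False using chambers_disjoint v W_id by blast
    qed
    then have lt: "\<tau> < b" using \<tau>ab by simp
    obtain e where e: "e > 0" "\<And>s. s \<in> R \<Longrightarrow> \<gamma> \<tau> \<in> pos s \<Longrightarrow> ball (\<gamma> \<tau>) e \<subseteq> pos s"
      using common_radius[of "\<gamma> \<tau>"] by blast
    define t where "t = min b (\<tau> + e / 2)"
    have t: "\<tau> < t" "t \<le> b" "t - \<tau> < e" using lt e(1) by (auto simp: t_def)
    then have tb: "\<gamma> t \<in> ball (\<gamma> \<tau>) e"
      using geod_on_dist[OF g, of \<tau> t] \<tau>ab by simp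
    have "\<gamma> t \<notin> neg s" if s: "s \<in> S" for s
    proof -
      note si = sides_R(1)[OF S_R[OF s]]
      have n\<tau>: "\<gamma> \<tau> \<notin> neg s" using \<tau>C s closure_C_iff by blast
      show ?thesis
      proof (cases "\<gamma> \<tau> \<in> pos s")
        case True
        then have "\<gamma> t \<in> pos s" using e(2)[OF S_R[OF s]] tb by blast
        then show ?thesis using sides_iff[OF si] by blast
      next
        case False
        then have "\<gamma> \<tau> \<in> fixset s" using n\<tau> sides_iff[OF si] by blast
        \<comment> \<open>Between the wall at time \<tau> and an endpoint in \<open>pos s\<close>
          the geodesic cannot enter \<open>neg s\<close>.\<close>
        then have "v x0 \<in> pos s" using neg s by blast
        then have "\<gamma> b \<notin> neg s" using gb sides_iff[OF si, of "v x0"] by simp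
        moreover have "geod_on \<gamma> \<tau> b" using geod_on_subset[OF g] \<tau>ab by simp
        ultimately show ?thesis
          using closed_half_space_convex[where \<gamma> = \<gamma>, OF cat si _ n\<tau>] t by simp
      qed
    qed
    then have "t \<in> T" using t \<tau>ab closure_C_iff by (auto simp: T_def)
    then show False using \<tau>(2) t by fastforce
  qed
  then show ?thesis using that \<tau>ab \<tau>C by (auto simp: fixset_def)
qed

text \<open>The start may be anywhere in the closed chamber because the induction restarts at the
  exit point. The two final clauses serve the two halves of the Hausdorff bound: covering places the
  segment near the vertices, common points place the edges near the segment.\<close>

lemma geodesic_gallery:
  assumes "v \<in> W" "geod_on \<gamma> a b" "a \<le> b" "\<gamma> a \<in> closure C" "\<gamma> b = v x0"
  shows "\<exists>ss. set ss \<subseteq> S \<and> word_prod ss = v \<and> length ss = word_length S v \<and>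
    (\<forall>t\<in>{a..b}. \<exists>i\<le>length ss. \<gamma> t \<in> word_prod (take i ss) ` closure C) \<and>
    (\<forall>i<length ss. \<exists>t\<in>{a..b}. \<gamma> t \<in> word_prod (take i ss) ` closure C \<and>
       \<gamma> t \<in> word_prod (take (Suc i) ss) ` closure C)"
  using assms
proof (induction "word_length S v" arbitrary: v \<gamma> a rule: less_induct)
  case less
  note v = \<open>v \<in> W\<close> and g = \<open>geod_on \<gamma> a b\<close> and ab = \<open>a \<le> b\<close>
    and ga = \<open>\<gamma> a \<in> closure C\<close> and gb = \<open>\<gamma> b = v x0\<close>
  show ?case
  proof (cases "v = id")
    case True
    have "\<gamma> b \<in> closure C" using gb True x0 closure_subset[of C] by auto
    then have "\<gamma> t \<in> closure C" if "t \<in> {a..b}" for t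
      using closure_C_convex[OF g ga] that by blast
    moreover have "word_length S v = 0"
      using word_length_le[of "[]" S] True by simp
    ultimately show ?thesis using True by (intro exI[of _ "[]"]) auto
  next
    case False
    obtain s \<tau> where s: "s \<in> S" "\<tau> \<in> {a..b}" "\<gamma> \<tau> \<in> closure C" "s (\<gamma> \<tau>) = \<gamma> \<tau>" "v x0 \<notin> pos s"
      by (rule leave_chamber[OF v False g ab ga gb])
    note sr = R_reflection[OF S_R[OF s(1)]]
    have inv: "s (s x) = x" for x using reflection_invol[OF sr] .
    obtain us where us: "set us \<subseteq> S" "word_prod us = v" "length us = word_length S v"
      using W_word[OF v] word_length_word by metis
    obtain vs where vs: "set vs \<subseteq> S" "Suc (length vs) = length us" "word_prod vs = s \<circ> v"
      using word_deletion[OF s(1) us(1)] us(2) s(5) by blast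
    have len: "word_length S (s \<circ> v) < word_length S v"
      using word_length_le[OF vs(1)] vs us(3) by simp
    \<comment> \<open>The rest of the geodesic is folded back by s: it still begins at the exit
      point, which s fixes, and it ends in the orbit point of the shorter element
      \<open>s \<circ> v\<close>.\<close>
    have g': "geod_on (s \<circ> \<gamma>) \<tau> b"
      using geod_on_isometry[OF reflection_isometry[OF sr] geod_on_subset[OF g]] s(2) by simp
    obtain ts where ts: "set ts \<subseteq> S" "word_prod ts = s \<circ> v" "length ts = word_length S (s \<circ> v)"
      and cov: "\<forall>t\<in>{\<tau>..b}. \<exists>i\<le>length ts. (s \<circ> \<gamma>) t \<in> word_prod (take i ts) ` closure C"
      and adj: "\<forall>i<length ts. \<exists>t\<in>{\<tau>..b}. (s \<circ> \<gamma>) t \<in> word_prod (take i ts) ` closure C \<and>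
         (s \<circ> \<gamma>) t \<in> word_prod (take (Suc i) ts) ` closure C"
      using less.hyps[OF len W_comp[OF R_W[OF S_R[OF s(1)]] v] g'] s(2-4) gb by auto
    have pull: "\<gamma> t \<in> word_prod (take (Suc i) (s # ts)) ` closure C"
      if st: "(s \<circ> \<gamma>) t \<in> word_prod (take i ts) ` closure C" for t i
    proof -
      obtain c where "c \<in> closure C" "s (\<gamma> t) = word_prod (take i ts) c"
        using st unfolding comp_apply by blast
      then show ?thesis using inv[of "\<gamma> t"] by (intro image_eqI[of _ _ c]) simp_all
    qed
    have prod: "word_prod (s # ts) = v" using ts(2) inv by (simp add: fun_eq_iff)
    have "length (s # ts) = word_length S v"
    proof (rule antisym)
      show "length (s # ts) \<le> word_length S v" using len ts(3) by simp
      show "word_length S v \<le> length (s # ts)"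
        using word_length_le[of "s # ts" S] prod ts(1) s(1) by simp
    qed
    moreover have "\<exists>i\<le>length (s # ts). \<gamma> t \<in> word_prod (take i (s # ts)) ` closure C"
      if t: "t \<in> {a..b}" for t
    proof (cases "t \<le> \<tau>")
      case True
      have "geod_on \<gamma> a \<tau>" using geod_on_subset[OF g] s(2) by simp
      then have "\<gamma> t \<in> closure C" using closure_C_convex[OF _ ga s(3)] True t by simp
      then show ?thesis by (intro exI[of _ 0]) simp
    next
      case False
      then have "t \<in> {\<tau>..b}" using t by simp
      then obtain i where i: "i \<le> length ts" "(s \<circ> \<gamma>) t \<in> word_prod (take i ts) ` closure C"
        using cov by blast
      have "Suc i \<le> length (s # ts)" using i(1) by simp
      then show ?thesis using pull[OF i(2)] by blast
    qed
    moreover have "\<exists>t\<in>{a..b}. \<gamma> t \<in> word_prod (take i (s # ts)) ` closure C \<and>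
       \<gamma> t \<in> word_prod (take (Suc i) (s # ts)) ` closure C" if i: "i < length (s # ts)" for i
    proof (cases i)
      case 0
      \<comment> \<open>Being fixed by s, the exit point is common to the first two closed
        chambers.\<close>
      have "\<gamma> \<tau> \<in> s ` closure C" using s(3,4) by (metis image_eqI)
      then show ?thesis using 0 s(2,3) by (intro bexI[of _ \<tau>]) simp_all
    next
      case (Suc j)
      then have "j < length ts" using i by simp
      then obtain t where t: "t \<in> {\<tau>..b}" "(s \<circ> \<gamma>) t \<in> word_prod (take j ts) ` closure C"
        "(s \<circ> \<gamma>) t \<in> word_prod (take (Suc j) ts) ` closure C"
        using adj by blast
      have "t \<in> {a..b}" using t(1) s(2) by simp
      then show ?thesis
        using pull[OF t(2)] pull[OF t(3)] unfolding Suc by blast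
    qed
    moreover have "set (s # ts) \<subseteq> S" using ts(1) s(1) by simp
    ultimately show ?thesis using prod by (intro exI[of _ "s # ts"] conjI ballI allI impI)
  qed
qed

lemma chamber_dist:
  assumes "u \<in> W" "p \<in> u ` closure C"
  shows "dist p (u x0) \<le> diameter (closure C)"
proof -
  obtain c where c: "c \<in> closure C" "p = u c" using assms by blast
  show ?thesis
    unfolding c(2) isometry_dist[OF W_isometry[OF assms(1)]]
    using c(1) x0 closure_subset by (intro closure_C_diameter) blast+
qed

lemma gallery_approximation:
  assumes w: "w \<in> W"
  shows "\<exists>ss. set ss \<subseteq> S \<and> word_prod ss = w \<and> length ss = word_length S w \<and>
    hausdorff_dist (geodesic_segment x0 (w x0)) (gallery_path ss x0) \<le> ereal (diameter (closure C))"
proof -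
  let ?D = "diameter (closure C)" and ?d = "dist x0 (w x0)"
  obtain \<gamma> where \<gamma>: "\<gamma> 0 = x0" "\<gamma> ?d = w x0" "geod_on \<gamma> 0 ?d"
    using CAT0_geodesic[OF cat] .
  have seg: "geodesic_segment x0 (w x0) = \<gamma> ` {0..?d}"
    by (rule CAT0_geodesic_segment[OF cat]) (simp add: geodesic_path_iff \<gamma>)
  have "\<gamma> 0 \<in> closure C" using \<gamma>(1) x0 closure_subset by auto
  from geodesic_gallery[OF w \<gamma>(3) _ this \<gamma>(2)]
  obtain ss where ss: "set ss \<subseteq> S" "word_prod ss = w" "length ss = word_length S w"
    and cov: "\<forall>t\<in>{0..?d}. \<exists>i\<le>length ss. \<gamma> t \<in> word_prod (take i ss) ` closure C"
    and adj: "\<forall>i<length ss. \<exists>t\<in>{0..?d}. \<gamma> t \<in> word_prod (take i ss) ` closure C \<and>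
       \<gamma> t \<in> word_prod (take (Suc i) ss) ` closure C"
    by auto
  have vW: "word_prod (take i ss) \<in> W" for i
    using ss(1) by (intro word_W) (meson order_trans set_take_subset)
  have D0: "0 \<le> ?D" using closure_C_diameter[of x0 x0] x0 closure_subset by auto
  \<comment> \<open>The explicit \<open>x0\<close> in \<open>gallery_path\<close> covers index 0 and
    the empty word; every other vertex ends the preceding edge.\<close>
  have vertex: "word_prod (take i ss) x0 \<in> gallery_path ss x0" if i: "i \<le> length ss" for i
  proof (cases i)
    case 0
    then show ?thesis by (simp add: gallery_path_def)
  next
    case (Suc j)
    let ?y = "word_prod (take j ss) x0" and ?z = "word_prod (take (Suc j) ss) x0"
    obtain \<delta> where \<delta>: "\<delta> 0 = ?y" "\<delta> (dist ?y ?z) = ?z" "geod_on \<delta> 0 (dist ?y ?z)"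
      using CAT0_geodesic[OF cat] .
    then have "geodesic_segment ?y ?z = \<delta> ` {0..dist ?y ?z}"
      by (intro CAT0_geodesic_segment[OF cat]) (simp add: geodesic_path_iff)
    moreover have "?z \<in> \<delta> ` {0..dist ?y ?z}"
      using \<delta>(2) by (intro image_eqI[of _ _ "dist ?y ?z"]) auto
    ultimately have "?z \<in> geodesic_segment ?y ?z" by (simp only:)
    moreover have "j \<in> {..<length ss}" using Suc i by simp
    ultimately show ?thesis unfolding gallery_path_def Suc by (rule insertI2[OF UN_I, rotated])
  qed
  have "infdist p (gallery_path ss x0) \<le> ?D" if p: "p \<in> geodesic_segment x0 (w x0)" for p
  proof -
    obtain i where i: "i \<le> length ss" "p \<in> word_prod (take i ss) ` closure C"
      using p cov unfolding seg by blast
    show ?thesis using infdist_le2[OF vertex[OF i(1)] chamber_dist[OF vW i(2)]] .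
  qed
  moreover have "infdist q (geodesic_segment x0 (w x0)) \<le> ?D" if q: "q \<in> gallery_path ss x0" for q
  proof (cases "q = x0")
    case True
    have "x0 \<in> geodesic_segment x0 (w x0)"
      unfolding seg using \<gamma>(1) by (intro image_eqI[of _ _ 0]) auto
    then show ?thesis using D0 True by simp
  next
    case False
    then obtain i where i: "i < length ss" "q \<in> geodesic_segment (word_prod (take i ss) x0) (word_prod (take (Suc i) ss) x0)"
      using q unfolding gallery_path_def by blast
    \<comment> \<open>Both ends of the edge are within the diameter of this common point of two
      closed chambers, hence the whole edge is.\<close>
    obtain t where t: "t \<in> {0..?d}" "\<gamma> t \<in> word_prod (take i ss) ` closure C"
      "\<gamma> t \<in> word_prod (take (Suc i) ss) ` closure C"
      using adj i(1) by blast
    have "dist q (\<gamma> t) \<le> ?D"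
      using chamber_dist[OF vW t(2)] chamber_dist[OF vW t(3)]
      by (intro CAT0_dist_segment_le[OF cat i(2)]) (simp_all add: dist_commute)
    then show ?thesis using t(1) unfolding seg by (intro infdist_le2[of "\<gamma> t"]) auto
  qed
  ultimately have "hausdorff_dist (geodesic_segment x0 (w x0)) (gallery_path ss x0) \<le> ereal ?D"
    unfolding hausdorff_dist_def by (intro max.boundedI SUP_least) simp_all
  then show ?thesis using ss by blast
qed

end

theorem theorem3p3:
  fixes W :: "('a::metric_space \<Rightarrow> 'a) set" and C :: "'a set" and S :: "('a \<Rightarrow> 'a) set"
    and x0 :: 'a and w :: "'a \<Rightarrow> 'a"
  assumes "CAT0 TYPE('a)"
    and "reflection_group W"
    and "acts_properly W"
    and "chamber W C"
    and "cocompact_discrete W C"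
    and "minimal_generating W C S"
    and "x0 \<in> C"
    and "w \<in> W"
  shows "\<exists>ss. set ss \<subseteq> S \<and> word_prod ss = w \<and> length ss = word_length S w \<and>
           hausdorff_dist (geodesic_segment x0 (w x0)) (gallery_path ss x0)
             \<le> ereal (diameter (closure C))"
proof -
  interpret reflection_chamber W C S x0
    using assms(1-7) by unfold_locales
  show ?thesis using assms(8) by (rule gallery_approximation)
qed

end
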